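(* Let $R$ be a $\mathbb{Q}$-domain, $n=2$, and let $D\in\mathrm{LND}_R R[x_1,x_2]$ be affine and such that $\psi^{-1}\circ D\circ\psi$ is not triangular for any $\psi\in\mathrm{Aff}(R,\mathbf{x})$. Then for $f\in\ker D$, $\exp fD\in\mathrm{T}(R,\mathbf{x})$ if and only if $f\in R$.
   Context: $D$ is affine if $\deg D(x_i)\le1$ for all $i$, triangular if $D(x_i)\in R[x_1,\dots,x_{i-1}]$ for all $i$. $\mathrm{LND}_R$ denotes locally nilpotent $R$-derivations; $\exp D(f)=\sum_l D^l(f)/l!$. $\mathrm{Aff}(R,\mathbf{x})$ and $\mathrm{T}(R,\mathbf{x})$ are the subgroups of $\mathrm{Aut}(R[\mathbf{x}]/R)$ generated by affine automorphisms ($\deg\phi(x_i)=1$), resp. by affine and elementary automorphisms (fixing all variables but one). *)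

theory Defs
  imports "HOL-Computational_Algebra.Polynomial"
begin

text \<open>R[x1,x2] is represented as ('a poly) poly = (R[x1])[x2]:
  the outer variable is x2, the inner variable is x1.\<close>

type_synonym 'a mpoly2 = "'a poly poly"

definition rconst :: "'a::comm_ring_1 \<Rightarrow> 'a mpoly2" where
  "rconst c = [:[:c:]:]"

definition X1 :: "'a::comm_ring_1 mpoly2" where
  "X1 = [:[:0, 1:]:]"

definition X2 :: "'a::comm_ring_1 mpoly2" where
  "X2 = [:0, 1:]"

definition in_R :: "'a::comm_ring_1 mpoly2 \<Rightarrow> bool" where
  "in_R p \<longleftrightarrow> (\<exists>c. p = rconst c)"

definition Q_domain :: "'a::idom itself \<Rightarrow> bool" where
  "Q_domain _ \<longleftrightarrow> (\<forall>n::nat. n > 0 \<longrightarrow> (of_nat n :: 'a) dvd 1)"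

text \<open>Total degree (degree of the zero polynomial is taken as 0;
  it only appears in upper bounds / equalities with 1).\<close>
definition tdeg :: "'a::zero mpoly2 \<Rightarrow> nat" where
  "tdeg p = (if p = 0 then 0
     else Max {i + degree (coeff p i) | i. i \<le> degree p \<and> coeff p i \<noteq> 0})"

definition R_derivation :: "('a::comm_ring_1 mpoly2 \<Rightarrow> 'a mpoly2) \<Rightarrow> bool" where
  "R_derivation D \<longleftrightarrow>
     (\<forall>a b. D (a + b) = D a + D b) \<and>
     (\<forall>c a. D (rconst c * a) = rconst c * D a) \<and>
     (\<forall>a b. D (a * b) = a * D b + b * D a)"

definition LND :: "('a::comm_ring_1 mpoly2 \<Rightarrow> 'a mpoly2) \<Rightarrow> bool" where
  "LND D \<longleftrightarrow> R_derivation D \<and> (\<forall>f. \<exists>m. (D ^^ m) f = 0)"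

definition affine_der :: "('a::comm_ring_1 mpoly2 \<Rightarrow> 'a mpoly2) \<Rightarrow> bool" where
  "affine_der D \<longleftrightarrow> tdeg (D X1) \<le> 1 \<and> tdeg (D X2) \<le> 1"

definition triangular_der :: "('a::comm_ring_1 mpoly2 \<Rightarrow> 'a mpoly2) \<Rightarrow> bool" where
  "triangular_der D \<longleftrightarrow> in_R (D X1) \<and> degree (D X2) = 0"

definition inv_fact :: "nat \<Rightarrow> 'a::idom" where
  "inv_fact l = (SOME c. c * of_nat (fact l) = 1)"

definition exp_der :: "('a::idom mpoly2 \<Rightarrow> 'a mpoly2) \<Rightarrow> 'a mpoly2 \<Rightarrow> 'a mpoly2" where
  "exp_der D g = (\<Sum>l < (LEAST m. (D ^^ m) g = 0). rconst (inv_fact l) * (D ^^ l) g)"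

definition subst2 :: "'a::comm_ring_1 mpoly2 \<Rightarrow> 'a mpoly2 \<Rightarrow> 'a mpoly2 \<Rightarrow> 'a mpoly2" where
  "subst2 p q f = poly (map_poly (\<lambda>a. poly (map_poly rconst a) p) f) q"

definition R_aut :: "('a::comm_ring_1 mpoly2 \<Rightarrow> 'a mpoly2) \<Rightarrow> bool" where
  "R_aut \<phi> \<longleftrightarrow> (\<exists>p q. \<phi> = subst2 p q) \<and> bij \<phi>"

definition affine_aut :: "('a::comm_ring_1 mpoly2 \<Rightarrow> 'a mpoly2) \<Rightarrow> bool" where
  "affine_aut \<phi> \<longleftrightarrow> R_aut \<phi> \<and> tdeg (\<phi> X1) = 1 \<and> tdeg (\<phi> X2) = 1"

definition elementary_aut :: "('a::comm_ring_1 mpoly2 \<Rightarrow> 'a mpoly2) \<Rightarrow> bool" where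
  "elementary_aut \<phi> \<longleftrightarrow> R_aut \<phi> \<and> (\<phi> X1 = X1 \<or> \<phi> X2 = X2)"

inductive_set gen_group :: "('b \<Rightarrow> 'b) set \<Rightarrow> ('b \<Rightarrow> 'b) set" for S where
  gen_id: "id \<in> gen_group S"
| gen_base: "\<phi> \<in> S \<Longrightarrow> \<phi> \<in> gen_group S"
| gen_comp: "\<phi> \<in> gen_group S \<Longrightarrow> \<psi> \<in> gen_group S \<Longrightarrow> \<phi> \<circ> \<psi> \<in> gen_group S"
| gen_inv: "\<phi> \<in> gen_group S \<Longrightarrow> inv \<phi> \<in> gen_group S"

definition Aff :: "('a::comm_ring_1 mpoly2 \<Rightarrow> 'a mpoly2) set" where
  "Aff = gen_group {\<phi>. affine_aut \<phi>}"

definition Tame :: "('a::comm_ring_1 mpoly2 \<Rightarrow> 'a mpoly2) set" where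
  "Tame = gen_group {\<phi>. affine_aut \<phi> \<or> elementary_aut \<phi>}"

end

(* Write phi = exp(fD). Since D^3 kills linear polynomials, phi(y) = y + f D(y) + f^2 D^2(y)/2 for
   linear y. Over a domain, every tame automorphism of the plane is affine or becomes, after
   composition with an affine automorphism, one whose two coordinates have strictly increasing
   degrees. Some nonconstant linear w has D(w) constant, so phi(w) has degree at most
   max(1, deg f). If f is not constant and y is a linear coordinate with D(y) nonconstant, then
   phi(y) has larger degree than phi(w), so no second linear coordinate can have larger degree.
   Hence tameness yields a linear coordinate y with D(y) constant, and D is triangular in any
   coordinate system starting with y. *)

theory Submission
  imports Defs
begin

section \<open>Homomorphisms of the polynomial ring\<close>

text \<open>Since R need not be a field, nonzero elements cannot be inverted, and this shapes most
  steps. The polynomial w with D(w) constant always exists, but its linear coefficients may generate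
  a proper ideal of R, so w need not be a coordinate and does not by itself make D triangular. It
  enters only through Cramer relations u * w = s * y + t * z + r with u and t nonzero. The
  alternating form of tame automorphisms survives over R because an affine factor is treated in one
  of two ways. If the coefficient of X2 in its image of X1 is 0, then the coefficient of X2 in its
  image of X2 is a unit, and the factor can be moved past an elementary one. Otherwise the factor
  stays, and a nonzero coefficient suffices to count degrees over a domain. The contradiction arises
  in one coordinate system: if phi = k o a with k reduced and a affine, then phi maps the
  coordinates a^-1(X1), a^-1(X2) to k(X1), k(X2).\<close>

definition rhom :: "('a::comm_ring_1 \<Rightarrow> 'b::comm_ring_1) \<Rightarrow> bool" where
  "rhom h \<longleftrightarrow> h 0 = 0 \<and> h 1 = 1 \<and> (\<forall>a b. h (a + b) = h a + h b) \<and> (\<forall>a b. h (a * b) = h a * h b)"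

lemma rhomD:
  assumes "rhom h"
  shows "h 0 = 0" "h 1 = 1" "h (a + b) = h a + h b" "h (a * b) = h a * h b"
    "h (- a) = - h a" "h (a - b) = h a - h b" "h (a ^ n) = h a ^ n"
proof -
  show 1: "h 0 = 0" "h 1 = 1" "h (a + b) = h a + h b" "h (a * b) = h a * h b" for a b
    using assms by (auto simp: rhom_def)
  have "h (a + - a) = h a + h (- a)" for a by (rule 1)
  then show 2: "h (- a) = - h a" for a
    by (simp add: 1 eq_neg_iff_add_eq_0 add.commute)
  show "h (a - b) = h a - h b"
    using 1(3)[of a "- b"] by (simp add: 2)
  show "h (a ^ n) = h a ^ n"
    by (induction n) (simp_all add: 1)
qed

lemma map_poly_rhom_pCons:
  assumes "rhom h"
  shows "map_poly h (pCons a f) = pCons (h a) (map_poly h f)"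
  by (rule poly_eqI) (simp add: coeff_map_poly coeff_pCons rhomD[OF assms] split: nat.split)

lemma poly_map_poly_rhom_add:
  assumes "rhom h"
  shows "poly (map_poly h (a + b)) p = poly (map_poly h a) p + poly (map_poly h b) p"
proof -
  have "map_poly h (a + b) = map_poly h a + map_poly h b"
    by (rule poly_eqI) (simp add: coeff_map_poly rhomD[OF assms])
  then show ?thesis by simp
qed

lemma rhom_poly_map_poly:
  assumes "rhom h"
  shows "rhom (\<lambda>a. poly (map_poly h a) p)"
proof -
  have smult: "map_poly h (smult c a) = smult (h c) (map_poly h a)" for c a
    by (rule poly_eqI) (simp add: coeff_map_poly rhomD[OF assms])
  have "poly (map_poly h (a * b)) p = poly (map_poly h a) p * poly (map_poly h b) p" for a b
    by (induction a)
      (simp_all add: poly_map_poly_rhom_add assms map_poly_rhom_pCons smult rhomD(1) algebra_simps)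
  then show ?thesis
    unfolding rhom_def
    by (simp add: poly_map_poly_rhom_add assms map_poly_1' rhomD(2))
qed

lemma rhom_rconst: "rhom rconst"
  unfolding rhom_def rconst_def by (simp add: one_pCons)

lemmas rconst_simps [simp] = rhomD(1-3,5-7)[OF rhom_rconst]

lemma rconst_mult: "rconst (a * b) = rconst a * rconst b"
  by (rule rhomD[OF rhom_rconst])

lemma rconst_eq_iff [simp]: "rconst a = rconst b \<longleftrightarrow> a = b"
  by (simp add: rconst_def)

lemma rconst_eq_0_iff [simp]: "rconst a = 0 \<longleftrightarrow> a = 0"
  by (simp add: rconst_def)

lemma pCons_eq_X2: "pCons a f = [:a:] + X2 * f"
  by (simp add: X2_def)

lemma const_pCons_eq_X1: "[:pCons c a:] = rconst c + X1 * [:a:]"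
  by (simp add: X1_def rconst_def)

text \<open>R[x1,x2] is generated as a ring by the constants and the two variables. This hides the
  nested representation in arguments about homomorphisms.\<close>

lemma mpoly2_induct [case_names const X1 X2 add mult]:
  assumes "\<And>c. P (rconst c)" "P X1" "P X2"
    and add: "\<And>f g. P f \<Longrightarrow> P g \<Longrightarrow> P (f + g)" and mult: "\<And>f g. P f \<Longrightarrow> P g \<Longrightarrow> P (f * g)"
  shows "P f"
proof -
  have inner: "P [:a:]" for a
  proof (induction a)
    case 0
    show ?case using assms(1)[of 0] by simp
  next
    case (pCons c a)
    then show ?case unfolding const_pCons_eq_X1 by (intro add mult assms)
  qed
  show ?thesis
  proof (induction f)
    case 0
    show ?case using inner[of 0] by simp
  next
    case (pCons a f)
    then show ?case unfolding pCons_eq_X2[of a f] by (intro add mult inner assms)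
  qed
qed

definition R_hom :: "('a::comm_ring_1 mpoly2 \<Rightarrow> 'b::comm_ring_1) \<Rightarrow> ('a \<Rightarrow> 'b) \<Rightarrow> bool" where
  "R_hom h c \<longleftrightarrow> rhom h \<and> (\<forall>a. h (rconst a) = c a)"

text \<open>The universal property of R[x1,x2] with an arbitrary target ring: \<open>subst2\<close>
  is one instance, homogenisation into R[x1,x2][t] another.\<close>

definition eval2 :: "('a::comm_ring_1 \<Rightarrow> 'b::comm_ring_1) \<Rightarrow> 'b \<Rightarrow> 'b \<Rightarrow> 'a mpoly2 \<Rightarrow> 'b" where
  "eval2 c p q f = poly (map_poly (\<lambda>a. poly (map_poly c a) p) f) q"

lemma subst2_eq_eval2: "subst2 = eval2 rconst"
  by (simp add: fun_eq_iff subst2_def eval2_def)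

lemma R_hom_eval2:
  assumes "rhom c"
  shows "R_hom (eval2 c p q) c"
  unfolding R_hom_def eval2_def
  using rhom_poly_map_poly[OF rhom_poly_map_poly[OF assms, of p], of q]
  by (simp add: rconst_def map_poly_rhom_pCons[OF assms] map_poly_rhom_pCons[OF rhom_poly_map_poly[OF assms]])

lemma eval2_X [simp]:
  assumes "rhom c"
  shows "eval2 c p q X1 = p" "eval2 c p q X2 = q"
  unfolding eval2_def
  by (simp_all add: X1_def X2_def map_poly_rhom_pCons[OF assms] rhomD[OF assms]
      map_poly_rhom_pCons[OF rhom_poly_map_poly[OF assms]] rhomD[OF rhom_poly_map_poly[OF assms]])

lemma R_hom_unique:
  assumes "R_hom h c" "R_hom k c" "h X1 = k X1" "h X2 = k X2"
  shows "h = k"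
proof
  show "h f = k f" for f
    using assms by (induction f rule: mpoly2_induct) (simp_all add: R_hom_def rhomD)
qed

abbreviation R_endo :: "('a::comm_ring_1 mpoly2 \<Rightarrow> 'a mpoly2) \<Rightarrow> bool" where
  "R_endo h \<equiv> R_hom h rconst"

lemma R_endo_subst2: "R_endo (subst2 p q)"
  unfolding subst2_eq_eval2 by (rule R_hom_eval2[OF rhom_rconst])

lemma subst2_X [simp]: "subst2 p q X1 = p" "subst2 p q X2 = q"
  unfolding subst2_eq_eval2 by (simp_all add: rhom_rconst)

lemma R_homD:
  assumes "R_hom h c"
  shows "h 0 = 0" "h 1 = 1" "h (a + b) = h a + h b" "h (a * b) = h a * h b"
    "h (- a) = - h a" "h (a - b) = h a - h b" "h (a ^ n) = h a ^ n" "h (rconst x) = c x"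
  using assms rhomD[of h] unfolding R_hom_def by auto

lemmas subst2_simps [simp] = R_homD[OF R_endo_subst2]

lemma R_endo_eq_subst2:
  assumes "R_endo h"
  shows "h = subst2 (h X1) (h X2)"
  by (rule R_hom_unique[OF assms R_endo_subst2]) simp_all

lemma R_endo_eqI:
  assumes "R_endo h" "R_endo k" "h X1 = k X1" "h X2 = k X2"
  shows "h = k"
  by (rule R_hom_unique[OF assms])

lemma R_hom_comp:
  assumes "R_hom h c" "R_endo k"
  shows "R_hom (h \<circ> k) c"
  using assms unfolding R_hom_def rhom_def by simp

lemma R_endo_id: "R_endo id"
  by (simp add: R_hom_def rhom_def)

lemma R_aut_iff: "R_aut h \<longleftrightarrow> R_endo h \<and> bij h"
  unfolding R_aut_def using R_endo_eq_subst2 R_endo_subst2 by blast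

section \<open>Total degree by homogenisation\<close>

text \<open>Sends each variable x to x * t in R[x1,x2][t], so that the degree in t is the total
  degree. As this is a ring homomorphism, degrees of products and substitutions over a domain reduce
  to facts on univariate polynomials.\<close>

definition homog :: "'a::comm_ring_1 mpoly2 \<Rightarrow> 'a mpoly2 poly" where
  "homog = eval2 (\<lambda>c. [:rconst c:]) [:0, X1:] [:0, X2:]"

definition dg :: "'a::comm_ring_1 mpoly2 \<Rightarrow> nat" where
  "dg p = degree (homog p)"

lemma rhom_const_rconst: "rhom (\<lambda>c. [:rconst c:])"
  unfolding rhom_def by (simp add: one_pCons rconst_mult)

lemma R_hom_homog: "R_hom homog (\<lambda>c. [:rconst c:])"
  unfolding homog_def by (rule R_hom_eval2[OF rhom_const_rconst])

lemmas homog_simps = R_homD[OF R_hom_homog]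

lemma homog_X: "homog X1 = [:0, X1:]" "homog X2 = [:0, X2:]"
  unfolding homog_def by (simp_all add: rhom_const_rconst)

lemma poly_homog_1: "poly (homog p) 1 = p"
  by (induction p rule: mpoly2_induct) (simp_all add: homog_simps homog_X)

lemma in_R_poly_homog_0: "in_R (poly (homog p) 0)"
proof (induction p rule: mpoly2_induct)
  case (mult f g)
  then show ?case by (auto simp: homog_simps in_R_def rconst_mult[symmetric])
next
  case (add f g)
  then show ?case unfolding in_R_def by (metis homog_simps(3) poly_add rconst_simps(3))
qed (use rconst_simps(1) in \<open>auto simp: homog_simps homog_X in_R_def intro: exI[of _ 0]\<close>)

lemma in_R_iff_dg: "in_R p \<longleftrightarrow> dg p = 0"
proof
  assume "in_R p"
  then show "dg p = 0" by (auto simp: in_R_def dg_def homog_simps)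
next
  assume "dg p = 0"
  then obtain a where "homog p = [:a:]" unfolding dg_def by (rule degree_eq_zeroE)
  \<comment> \<open>A polynomial constant in t takes the same value at t = 1, which is p, and at t =
    0, which is the constant term of p.\<close>
  with poly_homog_1[of p] in_R_poly_homog_0[of p] show "in_R p" by simp
qed

lemma homog_eq_0_iff: "homog p = 0 \<longleftrightarrow> p = 0"
  using poly_homog_1[of p] by (auto simp: homog_simps)

lemma dg_mult:
  fixes p q :: "'a::idom mpoly2"
  assumes "p \<noteq> 0" "q \<noteq> 0"
  shows "dg (p * q) = dg p + dg q"
  using assms by (simp add: dg_def homog_simps degree_mult_eq homog_eq_0_iff)

lemma dg_add_le: "dg (p + q) \<le> max (dg p) (dg q)"
  by (simp add: dg_def homog_simps degree_add_le_max)

lemma dg_add_eq_right: "dg p < dg q \<Longrightarrow> dg (p + q) = dg q"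
  by (simp add: dg_def homog_simps degree_add_eq_right)

lemma dg_rconst [simp]: "dg (rconst c) = 0"
  by (simp add: dg_def homog_simps)

lemma dg_0 [simp]: "dg 0 = 0"
  by (simp add: dg_def homog_simps)

lemma dg_rconst_mult [simp]:
  fixes p :: "'a::idom mpoly2"
  shows "c \<noteq> 0 \<Longrightarrow> dg (rconst c * p) = dg p"
  by (cases "p = 0") (simp_all add: dg_mult)

lemma dg_rconst_mult_le:
  fixes p :: "'a::idom mpoly2"
  shows "dg (rconst c * p) \<le> dg p"
  by (cases "c = 0") simp_all

text \<open>Homogenisation turns the substitution into a composition of univariate polynomials over
  a domain, where leading terms cannot cancel.\<close>

lemma dg_poly_map_rconst:
  fixes p :: "'a::idom mpoly2"
  shows "dg (poly (map_poly rconst r) p) = degree r * dg p"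
proof -
  have "homog (poly (map_poly rconst r) p) = pcompose (map_poly rconst r) (homog p)"
    by (induction r)
      (simp_all add: homog_simps map_poly_rhom_pCons[OF rhom_rconst] pcompose_pCons)
  moreover have "degree (map_poly rconst r) = degree r"
    by (rule degree_map_poly) simp
  ultimately show ?thesis by (simp add: dg_def degree_pcompose)
qed

section \<open>Polynomials of degree at most one\<close>

definition linp :: "'a::comm_ring_1 \<Rightarrow> 'a \<Rightarrow> 'a \<Rightarrow> 'a mpoly2" where
  "linp a b e = rconst a * X1 + rconst b * X2 + rconst e"

lemma linp_eq: "linp a b e = [:[:e, a:], [:b:]:]"
  by (simp add: linp_def X1_def X2_def rconst_def)

lemma linp_eq_iff [simp]: "linp a b e = linp a' b' e' \<longleftrightarrow> a = a' \<and> b = b' \<and> e = e'"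
  by (auto simp: linp_eq)

lemma rconst_eq_linp: "rconst e = linp 0 0 e" and X1_eq_linp: "X1 = linp 1 0 0"
  and X2_eq_linp: "X2 = linp 0 1 0"
  by (simp_all add: linp_eq X1_def X2_def rconst_def one_pCons)

lemma in_R_linp_iff [simp]: "in_R (linp a b e) \<longleftrightarrow> a = 0 \<and> b = 0"
  unfolding in_R_def rconst_eq_linp by auto

lemma dg_linp_le: "dg (linp a b e) \<le> 1"
  by (simp add: dg_def linp_def homog_simps homog_X)

lemma dg_linp: "a \<noteq> 0 \<or> b \<noteq> 0 \<Longrightarrow> dg (linp a b e) = 1"
  using dg_linp_le[of a b e] in_R_iff_dg[of "linp a b e"] by auto

lemma degree_le_1_conv:
  assumes "degree q \<le> 1"
  shows "q = [:coeff q 0, coeff q 1:]"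
  using assms by (intro poly_eqI) (auto simp: coeff_pCons coeff_eq_0 split: nat.split)

text \<open>Together with \<open>tdeg_linp\<close> this translates the conditions on
  \<open>tdeg\<close> into coefficients; all later degree estimates use \<open>dg\<close>.\<close>

lemma tdeg_le_1_imp_linp:
  assumes "tdeg p \<le> 1"
  shows "\<exists>a b e. p = linp a b e"
proof -
  have le: "i + degree (coeff p i) \<le> 1" if "coeff p i \<noteq> 0" for i
  proof -
    let ?S = "{i + degree (coeff p i) | i. i \<le> degree p \<and> coeff p i \<noteq> 0}"
    have "finite ?S" by simp
    moreover have "i + degree (coeff p i) \<in> ?S"
      using that le_degree by blast
    ultimately have "i + degree (coeff p i) \<le> Max ?S" by (rule Max_ge)
    moreover have "p \<noteq> 0" using that by auto
    ultimately show ?thesis using assms by (simp add: tdeg_def)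
  qed
  have d: "degree p \<le> 1"
    using le[of "degree p"] by (cases "p = 0") auto
  have d0: "degree (coeff p 0) \<le> 1"
    using le[of 0] by (cases "coeff p 0 = 0") auto
  have d1: "degree (coeff p 1) = 0"
    using le[of 1] by (cases "coeff p 1 = 0") auto
  have "coeff p 1 = [:coeff (coeff p 1) 0:]"
    using d1 by (metis degree_0_id)
  then show ?thesis
    using degree_le_1_conv[OF d] degree_le_1_conv[OF d0] by (metis linp_eq)
qed

lemma tdeg_linp:
  assumes "a \<noteq> 0 \<or> b \<noteq> 0"
  shows "tdeg (linp a b e) = 1"
proof -
  let ?p = "linp a b e"
  let ?S = "{i + degree (coeff ?p i) | i. i \<le> degree ?p \<and> coeff ?p i \<noteq> 0}"
  have fin: "finite ?S" by simp
  have le: "n \<le> 1" if "n \<in> ?S" for n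
  proof -
    from that obtain i where i: "n = i + degree (coeff ?p i)" "coeff ?p i \<noteq> 0" by blast
    then have "i = 0 \<or> i = 1"
      by (auto simp: linp_eq coeff_pCons split: nat.splits)
    with i show ?thesis by (auto simp: linp_eq)
  qed
  have mem: "1 \<in> ?S"
  proof (cases "b = 0")
    case True
    then show ?thesis using assms by (auto simp: linp_eq intro!: exI[of _ 0])
  next
    case False
    then show ?thesis using assms by (auto simp: linp_eq intro!: exI[of _ 1])
  qed
  have "Max ?S = 1" using fin le mem by (intro Max_eqI) auto
  moreover have "?p \<noteq> 0" using assms by (auto simp: linp_eq)
  ultimately show ?thesis by (simp add: tdeg_def)
qed

section \<open>Affine and elementary automorphisms\<close>

lemma R_endo_linp:
  assumes "R_endo h"
  shows "h (linp a b e) = rconst a * h X1 + rconst b * h X2 + rconst e"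
  by (simp add: linp_def R_homD[OF assms])

lemma linp_lin_comb:
  "rconst s * linp a b e + rconst t * linp c d e' + rconst r =
    linp (s * a + t * c) (s * b + t * d) (s * e + t * e' + r)"
  by (simp add: linp_def rconst_mult algebra_simps)

lemma R_endo_poly_map_rconst:
  assumes "R_endo h"
  shows "h (poly (map_poly rconst r) p) = poly (map_poly rconst r) (h p)"
  by (induction r) (simp_all add: R_homD[OF assms] map_poly_rhom_pCons[OF rhom_rconst])

text \<open>The affine automorphisms in matrix form; \<open>affine_aut_if_GA\<close> and
  \<open>GA_if_affine_aut\<close> give both inclusions. The determinant has to be a unit of R, not
  merely nonzero.\<close>

definition GA :: "('a::idom mpoly2 \<Rightarrow> 'a mpoly2) set" where
  "GA = {subst2 (linp a b e) (linp c d e') | a b e c d e'. (a * d - b * c) dvd 1}"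

lemma GA_R_endo: "h \<in> GA \<Longrightarrow> R_endo h"
  by (auto simp: GA_def R_endo_subst2)

lemma GA_E:
  assumes "h \<in> GA"
  obtains a b e c d e' where "h X1 = linp a b e" "h X2 = linp c d e'" "(a * d - b * c) dvd 1"
  using assms by (auto simp: GA_def)

lemma GA_I:
  assumes "R_endo h" "h X1 = linp a b e" "h X2 = linp c d e'" "(a * d - b * c) dvd 1"
  shows "h \<in> GA"
  using R_endo_eq_subst2[OF assms(1)] assms(2-4) unfolding GA_def by (metis (mono_tags, lifting) mem_Collect_eq)

lemma GA_comp:
  assumes "h \<in> GA" "k \<in> GA"
  shows "h \<circ> k \<in> GA"
proof -
  obtain a b e c d e' where h: "h X1 = linp a b e" "h X2 = linp c d e'" "(a * d - b * c) dvd 1"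
    using assms(1) by (rule GA_E)
  obtain s t r s' t' r' where k: "k X1 = linp s t r" "k X2 = linp s' t' r'" "(s * t' - t * s') dvd 1"
    using assms(2) by (rule GA_E)
  have "(a * d - b * c) * (s * t' - t * s') dvd 1"
    using mult_dvd_mono[OF h(3) k(3)] by simp
  also have "(a * d - b * c) * (s * t' - t * s') =
      (s * a + t * c) * (s' * b + t' * d) - (s * b + t * d) * (s' * a + t' * c)"
    by (simp add: algebra_simps)
  finally show ?thesis
    by (intro GA_I[OF R_hom_comp])
      (simp_all add: assms GA_R_endo R_endo_linp h k linp_lin_comb)
qed

lemma GA_id: "id \<in> GA"
  by (rule GA_I[OF R_endo_id, of 1 0 0 0 1 0]) (simp_all add: X1_eq_linp X2_eq_linp)

lemma GA_inverse:
  assumes "h \<in> GA"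
  obtains k where "k \<in> GA" "h \<circ> k = id" "k \<circ> h = id"
proof -
  obtain a b e c d e' where h: "h X1 = linp a b e" "h X2 = linp c d e'" "(a * d - b * c) dvd 1"
    using assms by (rule GA_E)
  from h(3) obtain u where "1 = (a * d - b * c) * u" by (rule dvdE)
  then have u: "u * (a * d - b * c) = 1" by (simp add: mult.commute)
  \<comment> \<open>The adjugate matrix scaled by the inverse \<open>u\<close> of the determinant,
    with constants that cancel the translation. Its determinant is u^2 times the old one, that is
    \<open>u\<close>.\<close>
  define k where "k = subst2 (linp (u * d) (- (u * b)) (u * (b * e' - d * e)))
    (linp (- (u * c)) (u * a) (u * (c * e - a * e')))"
  have k: "k X1 = linp (u * d) (- (u * b)) (u * (b * e' - d * e))"
    "k X2 = linp (- (u * c)) (u * a) (u * (c * e - a * e'))"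
    by (simp_all add: k_def)
  have "u * d * (u * a) - - (u * b) * - (u * c) = u * (u * (a * d - b * c))"
    by (simp add: algebra_simps)
  then have "u * d * (u * a) - - (u * b) * - (u * c) = u" using u by simp
  moreover have "u dvd 1" using u by (metis dvdI)
  ultimately have kGA: "k \<in> GA"
    by (intro GA_I[OF _ k]) (simp_all add: k_def R_endo_subst2)
  have *: "u * d * a - u * b * c = 1" using u by (simp add: algebra_simps)
  have "h \<circ> k = id"
  proof (rule R_endo_eqI)
    show "(h \<circ> k) X1 = id X1"
      using * by (simp add: k h GA_R_endo[OF assms] R_endo_linp linp_lin_comb X1_eq_linp[symmetric] del: rconst_simps)
        (simp add: X1_eq_linp algebra_simps)
    show "(h \<circ> k) X2 = id X2"
      using * by (simp add: k h GA_R_endo[OF assms] R_endo_linp linp_lin_comb del: rconst_simps)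
        (simp add: X2_eq_linp algebra_simps)
  qed (simp_all add: R_hom_comp GA_R_endo assms kGA R_endo_id)
  moreover have "k \<circ> h = id"
  proof (rule R_endo_eqI)
    have "a * (u * (b * e' - d * e)) + b * (u * (c * e - a * e')) + e = e - (u * d * a - u * b * c) * e"
      "c * (u * (b * e' - d * e)) + d * (u * (c * e - a * e')) + e' = e' - (u * d * a - u * b * c) * e'"
      by (simp_all add: algebra_simps)
    note c = this[unfolded *]
    show "(k \<circ> h) X1 = id X1"
      using * c by (simp add: k h GA_R_endo[OF kGA] R_endo_linp linp_lin_comb del: rconst_simps)
        (simp add: X1_eq_linp algebra_simps)
    show "(k \<circ> h) X2 = id X2"
      using * c by (simp add: k h GA_R_endo[OF kGA] R_endo_linp linp_lin_comb del: rconst_simps)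
        (simp add: X2_eq_linp algebra_simps)
  qed (simp_all add: R_hom_comp GA_R_endo assms kGA R_endo_id)
  ultimately show ?thesis using that kGA by blast
qed

lemma GA_bij: "h \<in> GA \<Longrightarrow> bij h"
  by (meson GA_inverse o_bij)

lemma affine_aut_if_GA:
  assumes "h \<in> GA"
  shows "affine_aut h"
proof -
  obtain a b e c d e' where h: "h X1 = linp a b e" "h X2 = linp c d e'" "(a * d - b * c) dvd 1"
    using assms by (rule GA_E)
  then have "a \<noteq> 0 \<or> b \<noteq> 0" "c \<noteq> 0 \<or> d \<noteq> 0" by auto
  then show ?thesis
    using h assms by (simp add: affine_aut_def R_aut_iff GA_R_endo GA_bij tdeg_linp)
qed

text \<open>A substitute for the chain rule at the origin.\<close>
lemma linear_coeffs_R_endo: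
  assumes "R_endo h"
  shows "\<exists>l m. coeff (coeff (h f) 0) 1 = l * coeff (coeff (h X1) 0) 1 + m * coeff (coeff (h X2) 0) 1 \<and>
    coeff (coeff (h f) 1) 0 = l * coeff (coeff (h X1) 1) 0 + m * coeff (coeff (h X2) 1) 0"
proof (induction f rule: mpoly2_induct)
  case (const c)
  show ?case by (intro exI[of _ 0]) (simp add: R_homD[OF assms], simp add: rconst_def)
next
  case X1
  show ?case by (intro exI[of _ 1] exI[of _ 0]) simp
next
  case X2
  show ?case by (intro exI[of _ 0] exI[of _ 1]) simp
next
  case (add f g)
  then obtain l m l' m' where
    "coeff (coeff (h f) 0) 1 = l * coeff (coeff (h X1) 0) 1 + m * coeff (coeff (h X2) 0) 1"
    "coeff (coeff (h f) 1) 0 = l * coeff (coeff (h X1) 1) 0 + m * coeff (coeff (h X2) 1) 0"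
    "coeff (coeff (h g) 0) 1 = l' * coeff (coeff (h X1) 0) 1 + m' * coeff (coeff (h X2) 0) 1"
    "coeff (coeff (h g) 1) 0 = l' * coeff (coeff (h X1) 1) 0 + m' * coeff (coeff (h X2) 1) 0"
    by blast
  then show ?case
    by (intro exI[of _ "l + l'"] exI[of _ "m + m'"]) (simp add: R_homD[OF assms] algebra_simps)
next
  case (mult f g)
  then obtain l m l' m' where *:
    "coeff (coeff (h f) 0) 1 = l * coeff (coeff (h X1) 0) 1 + m * coeff (coeff (h X2) 0) 1"
    "coeff (coeff (h f) 1) 0 = l * coeff (coeff (h X1) 1) 0 + m * coeff (coeff (h X2) 1) 0"
    "coeff (coeff (h g) 0) 1 = l' * coeff (coeff (h X1) 0) 1 + m' * coeff (coeff (h X2) 0) 1"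
    "coeff (coeff (h g) 1) 0 = l' * coeff (coeff (h X1) 1) 0 + m' * coeff (coeff (h X2) 1) 0"
    by blast
  \<comment> \<open>\<open>?c p\<close> is the value of \<open>h p\<close> at the origin; the
    witnesses are the product rule for the linear part of a product.\<close>
  let ?c = "\<lambda>p. coeff (coeff (h p) 0) 0"
  show ?case
    by (intro exI[of _ "?c f * l' + ?c g * l"] exI[of _ "?c f * m' + ?c g * m"])
      (use * in \<open>simp add: R_homD[OF assms] coeff_mult algebra_simps\<close>)
qed

text \<open>Comparing linear parts at the origin in \<open>h f = X1\<close> and
  \<open>h g = X2\<close> writes the identity matrix as a product with the matrix of
  \<open>h\<close>; taking determinants shows that its determinant divides 1.\<close>

lemma GA_if_affine_aut:
  assumes "affine_aut h"
  shows "h \<in> GA"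
proof -
  have h: "R_endo h" "bij h" using assms by (auto simp: affine_aut_def R_aut_iff)
  obtain a b e where 1: "h X1 = linp a b e"
    using assms tdeg_le_1_imp_linp[of "h X1"] by (auto simp: affine_aut_def)
  obtain c d e' where 2: "h X2 = linp c d e'"
    using assms tdeg_le_1_imp_linp[of "h X2"] by (auto simp: affine_aut_def)
  obtain f g where "h f = X1" "h g = X2" using h(2) by (metis bij_pointE)
  with linear_coeffs_R_endo[OF h(1), of f] linear_coeffs_R_endo[OF h(1), of g]
  obtain l m l' m' where "1 = l * a + m * c" "0 = l * b + m * d" "0 = l' * a + m' * c" "1 = l' * b + m' * d"
    unfolding 1 2 by (auto simp: linp_eq X1_def X2_def)
  then have "1 = (l * a + m * c) * (l' * b + m' * d) - (l * b + m * d) * (l' * a + m' * c)"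
    by simp
  also have "\<dots> = (a * d - b * c) * (l * m' - m * l')" by (simp add: algebra_simps)
  finally show ?thesis by (intro GA_I[OF h(1) 1 2] dvdI)
qed

text \<open>Shears only: a unit factor on X2 and the exchange of the variables are left to
  \<open>GA\<close>.\<close>

definition el :: "'a::comm_ring_1 poly \<Rightarrow> 'a mpoly2 \<Rightarrow> 'a mpoly2" where
  "el r = subst2 X1 (X2 + poly (map_poly rconst r) X1)"

lemma R_endo_el: "R_endo (el r)"
  by (simp add: el_def R_endo_subst2)

lemma el_X [simp]: "el r X1 = X1" "el r X2 = X2 + poly (map_poly rconst r) X1"
  by (simp_all add: el_def)

lemma el_0: "el 0 = id"
  by (rule R_endo_eqI[OF R_endo_el R_endo_id]) simp_all

lemma el_comp: "el r \<circ> el s = el (r + s)"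
  by (rule R_endo_eqI[OF R_hom_comp[OF R_endo_el R_endo_el] R_endo_el])
    (simp_all add: R_homD[OF R_endo_el] R_endo_poly_map_rconst[OF R_endo_el]
      poly_map_poly_rhom_add[OF rhom_rconst])

lemma poly_map_rconst_X1: "poly (map_poly rconst r) X1 = [:r:]"
proof (induction r)
  case (pCons a r)
  then show ?case by (simp only: map_poly_rhom_pCons[OF rhom_rconst] const_pCons_eq_X1 poly_pCons)
qed simp

lemma el_in_GA:
  assumes "degree r \<le> 1"
  shows "el r \<in> GA"
proof (rule GA_I[OF R_endo_el])
  show "el r X1 = linp 1 0 0" unfolding el_X by (rule X1_eq_linp)
  show "el r X2 = linp (coeff r 1) 1 (coeff r 0)"
    unfolding el_X poly_map_rconst_X1 using degree_le_1_conv[OF assms]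
    by (simp add: linp_eq X2_def one_pCons)
qed simp

text \<open>Fixing X1 makes \<open>h\<close> a substitution X2 := q over R[x1], that is
  \<open>pcompose\<close>. Hitting X2 forces q to have degree 1 in X2 with a leading coefficient
  that is a unit of R[x1], hence a unit of R.\<close>

lemma R_endo_fixing_X1:
  fixes h :: "'a::idom mpoly2 \<Rightarrow> 'a mpoly2"
  assumes "R_endo h" "surj h" "h X1 = X1"
  obtains u r where "u dvd 1" "h X2 = rconst u * X2 + poly (map_poly rconst r) X1"
proof -
  define q where "q = h X2"
  have hom: "R_hom (\<lambda>f. pcompose f q) rconst"
    by (simp add: R_hom_def rhom_def pcompose_add pcompose_mult pcompose_1 rconst_def)
  have h: "h = (\<lambda>f. pcompose f q)"
  proof (rule R_hom_unique[OF assms(1) hom])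
    show "h X1 = pcompose X1 q" by (simp add: assms(3)) (simp add: X1_def)
    show "h X2 = pcompose X2 q" by (simp add: q_def[symmetric]) (simp add: X2_def pcompose_pCons)
  qed
  obtain f where f: "pcompose f q = X2" using assms(2) h by (metis surj_def)
  have "degree f * degree q = 1"
    using arg_cong[OF f, of degree] by (simp add: degree_pcompose X2_def)
  then have deg: "degree f \<le> 1" "degree q \<le> 1" by simp_all
  define f0 f1 q0 q1 where "f0 = coeff f 0" "f1 = coeff f 1" "q0 = coeff q 0" "q1 = coeff q 1"
  have fq: "f = [:f0, f1:]" "q = [:q0, q1:]"
    unfolding f0_f1_q0_q1_def using deg by (simp_all only: degree_le_1_conv[symmetric])
  have "q1 * f1 = 1"
    using f unfolding fq by (simp add: X2_def pcompose_pCons mult.commute split: if_splits)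
  moreover from this have "q1 \<noteq> 0" "f1 \<noteq> 0" by auto
  then have "degree (q1 * f1) = degree q1 + degree f1" by (rule degree_mult_eq)
  with \<open>q1 * f1 = 1\<close> have "degree q1 = 0" "degree f1 = 0" by simp_all
  then obtain u v where "q1 = [:u:]" "f1 = [:v:]" by (meson degree_eq_zeroE)
  ultimately have "1 = u * v" and q1: "q1 = [:u:]" by (simp_all add: one_pCons mult.commute)
  then have u: "u dvd 1" by (intro dvdI)
  show ?thesis
  proof
    show "h X2 = rconst u * X2 + poly (map_poly rconst q0) X1"
      unfolding poly_map_rconst_X1 q_def[symmetric] fq(2) q1 by (simp add: rconst_def X2_def)
  qed (fact u)
qed

section \<open>Reduced words\<close>

text \<open>Words grow on the right because appending \<open>el r\<close> replaces the images (h X1,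
  h X2) by (h X1, h X2 + r(h X1)), which makes degrees easy to follow.\<close>

inductive_set words :: "('a::idom mpoly2 \<Rightarrow> 'a mpoly2) set" where
  id: "id \<in> words"
| affine: "h \<in> words \<Longrightarrow> a \<in> GA \<Longrightarrow> h \<circ> a \<in> words"
| el: "h \<in> words \<Longrightarrow> h \<circ> el r \<in> words"

lemma words_comp: "k \<in> words \<Longrightarrow> h \<in> words \<Longrightarrow> h \<circ> k \<in> words"
  by (induction rule: words.induct) (auto simp: comp_assoc[symmetric] intro: words.intros)

lemma GA_words: "a \<in> GA \<Longrightarrow> a \<in> words"
  using words.affine[OF words.id] by simp

lemma el_words: "el r \<in> words"
  using words.el[OF words.id] by simp

lemma words_inverse: "h \<in> words \<Longrightarrow> \<exists>k\<in>words. h \<circ> k = id \<and> k \<circ> h = id"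
proof (induction rule: words.induct)
  case id
  show ?case by (rule bexI[OF _ words.id]) simp
next
  case (affine h a)
  then obtain k where k: "k \<in> words" "h \<circ> k = id" "k \<circ> h = id" by blast
  obtain b where b: "b \<in> GA" "a \<circ> b = id" "b \<circ> a = id" using GA_inverse[OF affine(2)] by metis
  have "h \<circ> a \<circ> (b \<circ> k) = h \<circ> (a \<circ> b) \<circ> k" "b \<circ> k \<circ> (h \<circ> a) = b \<circ> (k \<circ> h) \<circ> a"
    by (simp_all only: comp_assoc)
  then have "h \<circ> a \<circ> (b \<circ> k) = id \<and> b \<circ> k \<circ> (h \<circ> a) = id"
    by (simp only: k b comp_id id_comp simp_thms)
  then show ?case
    by (rule bexI[OF _ words_comp[OF k(1) GA_words[OF b(1)]]])
next
  case (el h r)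
  then obtain k where k: "k \<in> words" "h \<circ> k = id" "k \<circ> h = id" by blast
  have b: "el r \<circ> el (- r) = id" "el (- r) \<circ> el r = id" by (simp_all add: el_comp el_0)
  have "h \<circ> el r \<circ> (el (- r) \<circ> k) = h \<circ> (el r \<circ> el (- r)) \<circ> k"
    "el (- r) \<circ> k \<circ> (h \<circ> el r) = el (- r) \<circ> (k \<circ> h) \<circ> el r"
    by (simp_all only: comp_assoc)
  then have "h \<circ> el r \<circ> (el (- r) \<circ> k) = id \<and> el (- r) \<circ> k \<circ> (h \<circ> el r) = id"
    by (simp only: k b comp_id id_comp simp_thms)
  then show ?case
    by (rule bexI[OF _ words_comp[OF k(1) el_words[of "- r"]]])
qed

lemma elementary_in_words:
  fixes h :: "'a::idom mpoly2 \<Rightarrow> 'a mpoly2"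
  assumes "elementary_aut h"
  shows "h \<in> words"
proof -
  have fix1: "h \<in> words" if "R_endo h" "surj h" "h X1 = X1" for h :: "'a mpoly2 \<Rightarrow> 'a mpoly2"
  proof -
    obtain u r where u: "u dvd 1" "h X2 = rconst u * X2 + poly (map_poly rconst r) X1"
      using R_endo_fixing_X1[OF \<open>R_endo h\<close> \<open>surj h\<close> \<open>h X1 = X1\<close>] .
    define a where "a = subst2 (linp 1 0 0) (linp 0 u 0)"
    have a: "a \<in> GA"
      by (rule GA_I[of _ 1 0 0 0 u 0]) (simp_all add: a_def R_endo_subst2 u(1))
    have aX: "a X1 = X1" "a X2 = rconst u * X2"
      by (simp_all add: a_def X1_eq_linp[symmetric]) (simp add: linp_def)
    have "h = a \<circ> el r"
      by (rule R_endo_eqI[OF \<open>R_endo h\<close> R_hom_comp[OF GA_R_endo[OF a] R_endo_el]])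
        (simp_all add: aX that u R_homD[OF GA_R_endo[OF a]] R_endo_poly_map_rconst[OF GA_R_endo[OF a]])
    then show ?thesis using words.el[OF GA_words[OF a]] by simp
  qed
  have h: "R_endo h" "bij h" using assms by (auto simp: elementary_aut_def R_aut_iff)
  consider "h X1 = X1" | "h X2 = X2" using assms by (auto simp: elementary_aut_def)
  then show ?thesis
  proof cases
    case 1
    then show ?thesis using fix1 h bij_is_surj by blast
  next
    case 2
    \<comment> \<open>Conjugation by the exchange of the variables reduces to the case that fixes
      X1.\<close>
    define w :: "'a mpoly2 \<Rightarrow> 'a mpoly2" where "w = subst2 X2 X1"
    have w: "w \<in> GA"
      by (rule GA_I[of _ 0 1 0 1 0 0]) (simp_all add: w_def R_endo_subst2, simp_all add: X1_eq_linp X2_eq_linp)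
    have wX: "w X1 = X2" "w X2 = X1" by (simp_all add: w_def)
    have ww: "w \<circ> w = id"
      by (rule R_endo_eqI[OF R_hom_comp R_endo_id]) (simp_all add: GA_R_endo w wX)
    have "w \<circ> h \<circ> w \<in> words"
    proof (rule fix1)
      show "R_endo (w \<circ> h \<circ> w)" by (intro R_hom_comp GA_R_endo w h)
      show "surj (w \<circ> h \<circ> w)" using GA_bij[OF w] h(2) by (intro bij_is_surj bij_comp)
      show "(w \<circ> h \<circ> w) X1 = X1" by (simp add: wX 2)
    qed
    then have "w \<circ> (w \<circ> h \<circ> w) \<circ> w \<in> words"
      by (rule words_comp[OF GA_words[OF w] words_comp[OF _ GA_words[OF w]]])
    also have "w \<circ> (w \<circ> h \<circ> w) \<circ> w = (w \<circ> w) \<circ> h \<circ> (w \<circ> w)" by (simp only: comp_assoc)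
    finally show ?thesis by (simp add: ww)
  qed
qed

lemma Tame_subset_words: "Tame \<subseteq> words"
proof
  show "h \<in> words" if "h \<in> Tame" for h :: "'a mpoly2 \<Rightarrow> 'a mpoly2"
    using that unfolding Tame_def
  proof (induction rule: gen_group.induct)
    case gen_id
    show ?case by (rule words.id)
  next
    case (gen_base \<phi>)
    then consider "affine_aut \<phi>" | "elementary_aut \<phi>" by blast
    then show ?case by cases (simp_all add: GA_words GA_if_affine_aut elementary_in_words)
  next
    case (gen_comp \<phi> \<psi>)
    show ?case by (rule words_comp[OF gen_comp.IH(2,1)])
  next
    case (gen_inv \<phi>)
    obtain k where "k \<in> words" "\<phi> \<circ> k = id" "k \<circ> \<phi> = id"
      using words_inverse[OF gen_inv.IH] by blast
    then show ?case by (simp add: inv_unique_comp)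
  qed
qed

text \<open>Alternating words ending in a shear that is not affine. \<open>degree (a X1)\<close> is
  the degree in X2: an inner affine factor must bring X2 into the image of X1, while the first one
  is arbitrary.\<close>

inductive_set reduced :: "('a::idom mpoly2 \<Rightarrow> 'a mpoly2) set" where
  base: "a \<in> GA \<Longrightarrow> degree r \<ge> 2 \<Longrightarrow> a \<circ> el r \<in> reduced"
| step: "h \<in> reduced \<Longrightarrow> a \<in> GA \<Longrightarrow> degree (a X1) \<noteq> 0 \<Longrightarrow> degree r \<ge> 2 \<Longrightarrow> h \<circ> a \<circ> el r \<in> reduced"

lemma degree_linp_eq_0_iff: "degree (linp a b e) = 0 \<longleftrightarrow> b = 0"
  by (simp add: linp_eq)

lemma dg_add_less: "dg p < n \<Longrightarrow> dg q < n \<Longrightarrow> dg (p + q) < n"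
  using dg_add_le[of p q] by simp

text \<open>After a shear \<open>h X2\<close> dominates, and it occurs in \<open>h (a X1)\<close>
  with a nonzero coefficient. Hence \<open>h (a X1)\<close> has the degree of \<open>h X2\<close>,
  \<open>h (a X2)\<close> has at most that degree, and the next shear multiplies it by
  \<open>degree r\<close>, which is at least 2.\<close>

lemma reduced_dg:
  assumes "h \<in> reduced"
  shows "R_endo h \<and> 1 \<le> dg (h X1) \<and> dg (h X1) < dg (h X2)"
  using assms
proof (induction rule: reduced.induct)
  case (base a r)
  obtain \<alpha> \<beta> e \<gamma> \<delta> e' where a: "a X1 = linp \<alpha> \<beta> e" "a X2 = linp \<gamma> \<delta> e'" "(\<alpha> * \<delta> - \<beta> * \<gamma>) dvd 1"
    using base(1) by (rule GA_E)
  note hom = GA_R_endo[OF base(1)]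
  have 1: "dg (a X1) = 1" using a(3) unfolding a(1) by (intro dg_linp) auto
  have "dg (a X2) \<le> 1" unfolding a(2) by (rule dg_linp_le)
  then have "dg (a X2 + poly (map_poly rconst r) (a X1)) = dg (poly (map_poly rconst r) (a X1))"
    using base(2) 1 by (intro dg_add_eq_right) (simp add: dg_poly_map_rconst)
  then show ?case
    using base(2) 1
    by (intro conjI R_hom_comp[OF hom R_endo_el]) (simp_all add: R_homD[OF hom] R_endo_poly_map_rconst[OF hom] dg_poly_map_rconst)
next
  case (step h a r)
  obtain \<alpha> \<beta> e \<gamma> \<delta> e' where a: "a X1 = linp \<alpha> \<beta> e" "a X2 = linp \<gamma> \<delta> e'" "(\<alpha> * \<delta> - \<beta> * \<gamma>) dvd 1"
    using step(2) by (rule GA_E)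
  from step have h: "R_endo h" "1 \<le> dg (h X1)" "dg (h X1) < dg (h X2)" by auto
  note hom = R_hom_comp[OF h(1) GA_R_endo[OF step(2)]]
  have \<beta>: "\<beta> \<noteq> 0" using step(3) by (simp add: a degree_linp_eq_0_iff)
  have "dg (h (a X1)) = dg ((rconst \<alpha> * h X1 + rconst e) + rconst \<beta> * h X2)"
    by (simp add: a R_endo_linp[OF h(1)] add_ac)
  also have "\<dots> = dg (rconst \<beta> * h X2)"
    by (rule dg_add_eq_right, rule dg_add_less)
      (use \<beta> h dg_rconst_mult_le[of \<alpha> "h X1"] in auto)
  finally have 1: "dg (h (a X1)) = dg (h X2)" using \<beta> by simp
  have "dg (h (a X2)) < Suc (dg (h X2))"
    unfolding a R_endo_linp[OF h(1)]
    by (intro dg_add_less) (use h dg_rconst_mult_le[of \<gamma> "h X1"] dg_rconst_mult_le[of \<delta> "h X2"] in auto)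
  moreover have "2 * dg (h X2) \<le> degree r * dg (h X2)"
    using step(4) by (rule mult_right_mono) simp
  ultimately have 2: "dg (h (a X2)) < degree r * dg (h X2)" "dg (h X2) < degree r * dg (h X2)"
    using h by linarith+
  then have "dg (h (a X2) + poly (map_poly rconst r) (h (a X1))) = degree r * dg (h X2)"
    using dg_add_eq_right[of "h (a X2)" "poly (map_poly rconst r) (h (a X1))"]
    by (simp add: dg_poly_map_rconst 1)
  then show ?case
    using 1 2 h
    by (intro conjI R_hom_comp[OF hom R_endo_el])
      (simp_all add: R_homD[OF hom, unfolded comp_def] R_endo_poly_map_rconst[OF hom, unfolded comp_def])
qed

text \<open>Such an \<open>a\<close> is triangular, so its diagonal entry \<delta> is a unit.
  Comparing the images of X2 requires \<delta> * s(X1) = r(\<alpha> * X1 + e), which can be solved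
  for s.\<close>

lemma GA_el_commute:
  assumes "a \<in> GA" "degree (a X1) = 0"
  obtains s where "a \<circ> el r = el s \<circ> a"
proof -
  obtain \<alpha> \<beta> e \<gamma> \<delta> e' where a: "a X1 = linp \<alpha> \<beta> e" "a X2 = linp \<gamma> \<delta> e'" "(\<alpha> * \<delta> - \<beta> * \<gamma>) dvd 1"
    using assms(1) by (rule GA_E)
  have \<beta>: "\<beta> = 0" using assms(2) by (simp add: a degree_linp_eq_0_iff)
  then have "\<delta> dvd 1" using a(3) by (simp add: dvd_mult_right)
  then obtain u where "1 = \<delta> * u" by (rule dvdE)
  then have u: "rconst \<delta> * rconst u = 1" by (simp add: rconst_mult[symmetric])
  define s where "s = smult u (pcompose r [:e, \<alpha>:])"
  have smult: "map_poly rconst (smult u q) = smult (rconst u) (map_poly rconst q)" for q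
    by (rule poly_eqI) (simp add: coeff_map_poly rconst_mult)
  have comp: "poly (map_poly rconst (pcompose r [:e, \<alpha>:])) X1 = poly (map_poly rconst r) (a X1)"
    unfolding poly_map_rconst_X1 a \<beta> linp_eq
  proof (induction r)
    case (pCons c r)
    show ?case
      using pCons(2)[symmetric]
      by (simp add: map_poly_rhom_pCons[OF rhom_rconst] pcompose_pCons) (simp add: rconst_def)
  qed simp
  have *: "rconst \<delta> * poly (map_poly rconst s) X1 = poly (map_poly rconst r) (a X1)"
    unfolding s_def smult comp[symmetric] using u by (simp add: mult.assoc[symmetric])
  note hom = GA_R_endo[OF assms(1)]
  have "a \<circ> el r = el s \<circ> a"
  proof (rule R_endo_eqI)
    show "(a \<circ> el r) X1 = (el s \<circ> a) X1"
      by (simp add: a \<beta> R_endo_linp[OF R_endo_el]) (simp add: linp_def)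
    show "(a \<circ> el r) X2 = (el s \<circ> a) X2"
      using * by (simp add: R_homD[OF hom] R_endo_poly_map_rconst[OF hom])
        (simp add: a(2) linp_def R_homD[OF R_endo_el] distrib_left)
  qed (simp_all add: R_hom_comp hom R_endo_el)
  then show ?thesis by (rule that)
qed

lemma reduced_GA_comp:
  assumes "h \<in> GA \<or> (\<exists>k\<in>reduced. \<exists>a\<in>GA. h = k \<circ> a)" "b \<in> GA"
  shows "h \<circ> b \<in> GA \<or> (\<exists>k\<in>reduced. \<exists>a\<in>GA. h \<circ> b = k \<circ> a)"
  using assms(1)
proof (elim disjE bexE)
  assume "h \<in> GA"
  then show ?thesis by (intro disjI1 GA_comp assms(2))
next
  fix k a assume ka: "k \<in> reduced" "a \<in> GA" "h = k \<circ> a"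
  then have "h \<circ> b = k \<circ> (a \<circ> b)" by (simp only: comp_assoc)
  then show ?thesis
    by (intro disjI2 bexI[OF _ ka(1)] bexI[OF _ GA_comp[OF ka(2) assms(2)]])
qed

text \<open>A new shear is either appended, if the trailing affine factor brings X2 into the image
  of X1, or moved past that factor and merged with the last shear.\<close>

lemma words_cases:
  assumes "h \<in> words"
  shows "h \<in> GA \<or> (\<exists>k\<in>reduced. \<exists>a\<in>GA. h = k \<circ> a)"
  using assms
proof (induction rule: words.induct)
  case id
  show ?case using GA_id by blast
next
  case (affine h a)
  show ?case by (rule reduced_GA_comp[OF affine.IH affine.hyps(2)])
next
  case (el h r)
  show ?case
  proof (cases "degree r \<le> 1")
    case True
    show ?thesis by (rule reduced_GA_comp[OF el.IH el_in_GA[OF True]])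
  next
    case False
    then have r: "degree r \<ge> 2" by simp
    from el(2) consider "h \<in> GA" | k a where "k \<in> reduced" "a \<in> GA" "h = k \<circ> a" by blast
    then show ?thesis
    proof cases
      case 1
      then have "h \<circ> el r \<in> reduced" using r by (rule reduced.base)
      then show ?thesis by (intro disjI2 bexI[of _ "h \<circ> el r"] bexI[OF _ GA_id]) simp_all
    next
      case (2 k a)
      show ?thesis
      proof (cases "degree (a X1) = 0")
        case False
        then have "h \<circ> el r \<in> reduced" using 2 r by (auto intro: reduced.step)
        then show ?thesis by (intro disjI2 bexI[of _ "h \<circ> el r"] bexI[OF _ GA_id]) simp_all
      next
        case True
        obtain s where s: "a \<circ> el r = el s \<circ> a" using GA_el_commute[OF 2(2) True] .
        have h: "h \<circ> el r = k \<circ> el s \<circ> a"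
          unfolding 2(3) comp_assoc s ..
        from 2(1) show ?thesis
        proof cases
          case (base b t)
          \<comment> \<open>Leading terms of t and s may cancel. If the degree drops to at most 1,
            the merged shear is affine and the word becomes shorter.\<close>
          have k: "k \<circ> el s = b \<circ> el (t + s)" by (simp only: base el_comp comp_assoc)
          show ?thesis
          proof (cases "degree (t + s) \<le> 1")
            case True
            then show ?thesis unfolding h k using base 2 by (intro disjI1 GA_comp el_in_GA)
          next
            case False
            then have "b \<circ> el (t + s) \<in> reduced" using base by (intro reduced.base) simp_all
            then show ?thesis unfolding h k using 2 by blast
          qed
        next
          case (step k' b t)
          have k: "k \<circ> el s = k' \<circ> b \<circ> el (t + s)" by (simp only: step el_comp comp_assoc)
          show ?thesis
          proof (cases "degree (t + s) \<le> 1")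
            case True
            then have "b \<circ> el (t + s) \<circ> a \<in> GA" using step 2 by (intro GA_comp el_in_GA)
            moreover have "k' \<circ> b \<circ> el (t + s) \<circ> a = k' \<circ> (b \<circ> el (t + s) \<circ> a)"
              by (simp only: comp_assoc)
            ultimately show ?thesis
              unfolding h k by (intro disjI2 bexI[OF _ step(2)]) (rule bexI)
          next
            case False
            then have "k' \<circ> b \<circ> el (t + s) \<in> reduced" using step by (intro reduced.step) simp_all
            then show ?thesis unfolding h k using 2 by blast
          qed
        qed
      qed
    qed
  qed
qed

section \<open>Locally nilpotent derivations\<close>

lemma in_R_rconst [simp]: "in_R (rconst c)"
  by (auto simp: in_R_def)

lemma in_R_rconst_mult: "in_R p \<Longrightarrow> in_R (rconst c * p)"
  unfolding in_R_def by (metis rconst_mult)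

lemma in_R_rconst_mult_iff:
  fixes p :: "'a::idom mpoly2"
  shows "in_R (rconst c * p) \<longleftrightarrow> c = 0 \<or> in_R p"
  by (cases "c = 0") (simp_all add: in_R_iff_dg)

lemma R_derivationD:
  assumes "R_derivation D"
  shows "D (a + b) = D a + D b" "D (rconst c * a) = rconst c * D a" "D (a * b) = a * D b + b * D a"
    "D (rconst c) = 0" "D 0 = 0"
proof -
  show 1: "D (a + b) = D a + D b" "D (rconst c * a) = rconst c * D a" "D (a * b) = a * D b + b * D a" for a b c
    using assms by (auto simp: R_derivation_def)
  have "D 1 = 0" using 1(3)[of 1 1] by simp
  then show "D (rconst c) = 0" for c using 1(2)[of c 1] by simp
  from this[of 0] show "D 0 = 0" by simp
qed

lemma in_R_D_eq_0: "R_derivation D \<Longrightarrow> in_R p \<Longrightarrow> D p = 0"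
  by (auto simp: in_R_def R_derivationD)

lemma R_derivation_linp:
  assumes "R_derivation D"
  shows "D (linp a b e) = rconst a * D X1 + rconst b * D X2"
  by (simp add: linp_def R_derivationD[OF assms])

lemma R_derivation_power:
  assumes "R_derivation D"
  shows "(D ^^ n) (a + b) = (D ^^ n) a + (D ^^ n) b" "(D ^^ n) (rconst c * a) = rconst c * (D ^^ n) a"
    "(D ^^ n) 0 = 0"
  by (induction n) (simp_all add: R_derivationD[OF assms])

lemma R_derivation_power_eq_0:
  assumes "R_derivation D" "(D ^^ m) g = 0" "m \<le> n"
  shows "(D ^^ n) g = 0"
proof -
  have "(D ^^ n) g = (D ^^ (n - m)) ((D ^^ m) g)"
    using assms(3) by (simp flip: funpow_add[THEN fun_cong, unfolded comp_apply])
  then show ?thesis by (simp add: assms(2) R_derivation_power(3)[OF assms(1)])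
qed

text \<open>A locally nilpotent derivation has no nonzero eigenvalues modulo constants.\<close>
lemma LND_eigen:
  fixes D :: "'a::idom mpoly2 \<Rightarrow> 'a mpoly2"
  assumes "LND D" "rconst u * D g = rconst t * g + rconst c"
  shows "t = 0 \<or> in_R g"
proof -
  have D: "R_derivation D" using assms(1) by (simp add: LND_def)
  \<comment> \<open>The powers of \<open>u\<close> replace division: over the fraction field this
    says that D^n g is (t/u)^n g up to a constant when u is nonzero.\<close>
  have *: "\<exists>k. rconst (u ^ n) * (D ^^ n) g = rconst (t ^ n) * g + rconst k" for n
  proof (induction n)
    case 0
    show ?case by (rule exI[of _ 0]) simp
  next
    case (Suc n)
    then obtain k where k: "rconst (u ^ n) * (D ^^ n) g = rconst (t ^ n) * g + rconst k" ..
    have "rconst (u ^ Suc n) * (D ^^ Suc n) g = rconst u * D (rconst (u ^ n) * (D ^^ n) g)"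
      by (simp add: R_derivationD(2)[OF D] rconst_mult mult_ac del: rconst_simps)
    also have "\<dots> = rconst (t ^ n) * (rconst u * D g)"
      unfolding k by (simp only: R_derivationD(1,2,4)[OF D] add_0_right mult.left_commute)
    also have "\<dots> = rconst (t ^ Suc n) * g + rconst (t ^ n * c)"
      unfolding assms(2) by (simp add: rconst_mult algebra_simps)
    finally show ?case by blast
  qed
  obtain n where "(D ^^ n) g = 0" using assms(1) by (auto simp: LND_def)
  with *[of n] obtain k where "rconst (t ^ n) * g + rconst k = 0" by auto
  then have "rconst (t ^ n) * g = rconst (- k)" by (simp add: eq_neg_iff_add_eq_0)
  then have "in_R (rconst (t ^ n) * g)" by (simp only: in_R_rconst)
  then show ?thesis by (auto simp only: in_R_rconst_mult_iff power_eq_0_iff)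
qed

section \<open>Affine locally nilpotent derivations on polynomials of degree at most one\<close>

definition linear :: "'a::comm_ring_1 mpoly2 \<Rightarrow> bool" where
  "linear p \<longleftrightarrow> (\<exists>a b e. p = linp a b e)"

lemma linear_linp [simp]: "linear (linp a b e)"
  by (auto simp: linear_def)

lemma linear_X [simp]: "linear X1" "linear X2"
  by (simp_all add: X1_eq_linp X2_eq_linp)

lemma linear_dg: "linear p \<Longrightarrow> dg p \<le> 1"
  by (auto simp: linear_def intro: order.trans[OF dg_linp_le])

lemma linear_R_derivation:
  assumes "R_derivation D" "affine_der D" "linear p"
  shows "linear (D p)"
proof -
  obtain a b e where p: "p = linp a b e" using assms(3) by (auto simp: linear_def)
  obtain a1 b1 e1 a2 b2 e2 where D: "D X1 = linp a1 b1 e1" "D X2 = linp a2 b2 e2"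
    using assms(2) tdeg_le_1_imp_linp[of "D X1"] tdeg_le_1_imp_linp[of "D X2"]
    unfolding affine_der_def by blast
  show ?thesis
    using linp_lin_comb[of a a1 b1 e1 b a2 b2 e2 0]
    by (simp add: p R_derivation_linp[OF assms(1)] D)
qed

text \<open>The last nonconstant iterate of X1 under D serves as w.\<close>

lemma affine_LND_constant_image:
  fixes D :: "'a::idom mpoly2 \<Rightarrow> 'a mpoly2"
  assumes "LND D" "affine_der D"
  obtains w where "linear w" "\<not> in_R w" "in_R (D w)"
proof -
  have D: "R_derivation D" using assms(1) by (simp add: LND_def)
  define n where "n = (LEAST n. in_R ((D ^^ n) X1))"
  obtain k where "(D ^^ k) X1 = 0" using assms(1) by (auto simp: LND_def)
  then have "in_R ((D ^^ k) X1)" using in_R_rconst[of 0] by simp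
  then have n: "in_R ((D ^^ n) X1)" unfolding n_def by (rule LeastI)
  have "\<not> in_R X1" by (simp add: X1_eq_linp)
  then obtain m where m: "n = Suc m" using n by (cases n) auto
  have "linear ((D ^^ i) X1)" for i
    by (induction i) (simp_all add: linear_R_derivation[OF D assms(2)])
  moreover have "\<not> in_R ((D ^^ m) X1)"
    using not_less_Least[of m "\<lambda>n. in_R ((D ^^ n) X1)"] m by (simp add: n_def)
  moreover have "in_R (D ((D ^^ m) X1))" using n m by simp
  ultimately show ?thesis by (rule that)
qed

text \<open>Cramer's rule without division: it expresses a linear polynomial through two others
  whose determinant need not be a unit.\<close>

lemma cramer_linp:
  "rconst (a * d - b * c) * linp s t r =
    rconst (s * d - t * c) * linp a b e + rconst (a * t - b * s) * linp c d e'
    + rconst ((a * d - b * c) * r - (s * d - t * c) * e - (a * t - b * s) * e')"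
proof -
  have "rconst k * linp s t r = linp (k * s) (k * t) (k * r)" for k
    by (simp add: linp_def rconst_mult algebra_simps)
  then show ?thesis
    unfolding linp_lin_comb by (simp del: rconst_simps) (simp add: algebra_simps)
qed

text \<open>The linear part of D is nilpotent of size two, hence has square zero.\<close>
lemma affine_LND_square:
  fixes D :: "'a::idom mpoly2 \<Rightarrow> 'a mpoly2"
  assumes "LND D" "affine_der D" "linear y"
  shows "in_R (D (D y))"
proof (cases "in_R (D y)")
  case True
  then show ?thesis using assms(1) in_R_rconst[of 0] by (simp add: LND_def in_R_D_eq_0)
next
  case False
  have D: "R_derivation D" using assms(1) by (simp add: LND_def)
  obtain w where w: "linear w" "\<not> in_R w" "in_R (D w)"
    using affine_LND_constant_image[OF assms(1,2)] .
  obtain a b e where y: "y = linp a b e" using assms(3) by (auto simp: linear_def)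
  obtain c d e' where w': "w = linp c d e'" using w(1) by (auto simp: linear_def)
  obtain s t r where Dy: "D y = linp s t r"
    using linear_R_derivation[OF D assms(2,3)] by (auto simp: linear_def)
  define u where "u = a * d - b * c"
  \<comment> \<open>Were the linear parts of y and w proportional over the fraction field, D y would
    be proportional to the constant D w.\<close>
  have u: "u \<noteq> 0"
  proof
    assume "u = 0"
    moreover have "rconst c * D y - rconst a * D w = rconst (- u) * D X2"
      "rconst d * D y - rconst b * D w = rconst u * D X1"
      unfolding y w' R_derivation_linp[OF D] u_def
      by (simp_all add: rconst_mult algebra_simps)
    ultimately have "rconst c * D y = rconst a * D w" "rconst d * D y = rconst b * D w"
      by simp_all
    then have "in_R (rconst c * D y)" "in_R (rconst d * D y)"
      using w(3) by (simp_all add: in_R_rconst_mult)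
    then have "c = 0" "d = 0" using False by (simp_all add: in_R_rconst_mult_iff)
    then show False using w(2) by (simp add: w')
  qed
  obtain k where k: "D w = rconst k" using w(3) by (auto simp: in_R_def)
  \<comment> \<open>D y is expanded in y, w and 1 with denominator u, and D is applied. As D w is
    constant, \<open>s * d - t * c\<close> over u is an eigenvalue of D on D y modulo constants, so
    it vanishes.\<close>
  have "D (rconst u * D y) = rconst (s * d - t * c) * D y + rconst (a * t - b * s) * D w"
    unfolding Dy u_def cramer_linp[of a d b c s t r e e'] y[symmetric] w'[symmetric]
    by (simp only: R_derivationD(1,2,4)[OF D] Dy[symmetric] add_0_right)
  then have *: "rconst u * D (D y) = rconst (s * d - t * c) * D y + rconst ((a * t - b * s) * k)"
    by (simp only: R_derivationD(2)[OF D] k rconst_mult)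
  then have "s * d - t * c = 0"
    using LND_eigen[OF assms(1) *] False by blast
  with * have "in_R (rconst u * D (D y))" by (simp only: rconst_simps(1) mult_zero_left add_0_left in_R_rconst)
  then show ?thesis using u by (simp add: in_R_rconst_mult_iff)
qed

section \<open>Conjugation by affine automorphisms\<close>

lemma GA_inv:
  assumes "h \<in> GA"
  shows "inv h \<in> GA" "h (inv h x) = x" "inv h (h x) = x"
proof -
  obtain k where k: "k \<in> GA" "h \<circ> k = id" "k \<circ> h = id" using GA_inverse[OF assms] .
  then show "inv h \<in> GA" using inv_unique_comp[OF k(2,3)] by simp
  show "h (inv h x) = x" "inv h (h x) = x"
    using GA_bij[OF assms] by (simp_all add: bij_is_surj surj_f_inv_f bij_is_inj)
qed

lemma linear_GA:
  assumes "h \<in> GA" "linear p"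
  shows "linear (h p)"
proof -
  obtain a b e where p: "p = linp a b e" using assms(2) by (auto simp: linear_def)
  obtain a1 b1 e1 a2 b2 e2 where h: "h X1 = linp a1 b1 e1" "h X2 = linp a2 b2 e2"
    using assms(1) by (rule GA_E)
  show ?thesis
    by (simp add: p R_endo_linp[OF GA_R_endo[OF assms(1)]] h linp_lin_comb)
qed

lemma LND_conj:
  assumes "LND D" "h \<in> GA"
  shows "LND (inv h \<circ> D \<circ> h)"
proof -
  have D: "R_derivation D" using assms(1) by (simp add: LND_def)
  note hom = R_homD[OF GA_R_endo[OF assms(2)]] R_homD[OF GA_R_endo[OF GA_inv(1)[OF assms(2)]]]
  have "((inv h \<circ> D \<circ> h) ^^ n) g = inv h ((D ^^ n) (h g))" for n g
    by (induction n) (simp_all add: GA_inv(2,3)[OF assms(2)])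
  moreover have "\<exists>n. (D ^^ n) (h g) = 0" for g using assms(1) by (auto simp: LND_def)
  ultimately have "\<exists>n. ((inv h \<circ> D \<circ> h) ^^ n) g = 0" for g by (metis hom(9))
  moreover have "R_derivation (inv h \<circ> D \<circ> h)"
    unfolding R_derivation_def comp_apply
    by (intro conjI allI)
      (simp_all only: hom(3,4,8,9,11,12,16) R_derivationD(1-4)[OF D]
        GA_inv(2,3)[OF assms(2)] mult_zero_right add_0_right)
  ultimately show ?thesis by (simp only: LND_def simp_thms)
qed

text \<open>In the new coordinates D'(X1) is constant, so the coefficient t of X2 in D'(X2) is an
  eigenvalue of D' on D'(X2) modulo constants. Local nilpotency then gives t = 0.\<close>

lemma triangular_conj:
  fixes D :: "'a::idom mpoly2 \<Rightarrow> 'a mpoly2"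
  assumes "LND D" "affine_der D" "h \<in> GA" "in_R (D (h X1))"
  shows "triangular_der (inv h \<circ> D \<circ> h)"
proof -
  have D: "R_derivation D" using assms(1) by (simp add: LND_def)
  define D' where "D' = inv h \<circ> D \<circ> h"
  have LND': "LND D'" unfolding D'_def by (rule LND_conj[OF assms(1,3)])
  then have D'_der: "R_derivation D'" by (simp add: LND_def)
  obtain k where "D (h X1) = rconst k" using assms(4) by (auto simp: in_R_def)
  then have X1: "D' X1 = rconst k"
    by (simp add: D'_def R_homD[OF GA_R_endo[OF GA_inv(1)[OF assms(3)]]])
  have "linear (D' X2)"
    unfolding D'_def comp_apply
    by (rule linear_GA[OF GA_inv(1)[OF assms(3)]
          linear_R_derivation[OF D assms(2) linear_GA[OF assms(3) linear_X(2)]]])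
  then obtain s t r where X2: "D' X2 = linp s t r" by (auto simp: linear_def)
  have "rconst 1 * D' (D' X2) = rconst t * D' X2 + rconst (s * k)"
    unfolding X2 R_derivation_linp[OF D'_der] X1 by (simp add: rconst_mult)
  then have "t = 0 \<or> in_R (D' X2)" by (rule LND_eigen[OF LND'])
  then have "t = 0" by (auto simp: X2)
  then show ?thesis
    unfolding D'_def[symmetric] triangular_der_def X1 X2 by (simp add: degree_linp_eq_0_iff)
qed

section \<open>Exponentials\<close>

lemma inv_fact:
  assumes "Q_domain TYPE('a::idom)"
  shows "(inv_fact n :: 'a) * of_nat (fact n) = 1"
proof -
  have "(of_nat (fact n) :: 'a) dvd 1" using assms unfolding Q_domain_def by (meson fact_gt_zero)
  then have "\<exists>c::'a. c * of_nat (fact n) = 1" by (metis dvdE mult.commute)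
  then show ?thesis unfolding inv_fact_def by (rule someI_ex)
qed

lemma Q_domain_of_nat_neq_0:
  assumes "Q_domain TYPE('a::idom)" "n > 0"
  shows "(of_nat n :: 'a) \<noteq> 0"
  using assms by (metis Q_domain_def dvd_0_left zero_neq_one)

lemma inv_fact_Suc:
  assumes "Q_domain TYPE('a::idom)"
  shows "of_nat (Suc n) * (inv_fact (Suc n) :: 'a) = inv_fact n"
proof -
  have "of_nat (Suc n) * (inv_fact (Suc n) :: 'a) * of_nat (fact n) = inv_fact (Suc n) * of_nat (fact (Suc n))"
    by (simp add: algebra_simps)
  also have "\<dots> = inv_fact n * of_nat (fact n)" by (simp only: inv_fact[OF assms])
  finally show ?thesis
    using Q_domain_of_nat_neq_0[OF assms fact_gt_zero, of n] by (simp only: mult_cancel_right) simp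
qed

text \<open>Frees the sum from \<open>LEAST\<close>: any bound past the nilpotency index of g gives
  the same value.\<close>

lemma exp_der_eq_sum:
  assumes "R_derivation E" "(E ^^ m) g = 0"
  shows "exp_der E g = (\<Sum>l<m. rconst (inv_fact l) * (E ^^ l) g)"
proof -
  define k where "k = (LEAST m. (E ^^ m) g = 0)"
  have k: "(E ^^ k) g = 0" "k \<le> m"
    unfolding k_def using assms(2) by (auto intro: LeastI Least_le)
  have "rconst (inv_fact l) * (E ^^ l) g = 0" if "k \<le> l" for l
    using R_derivation_power_eq_0[OF assms(1) k(1) that] by simp
  then show ?thesis
    unfolding exp_der_def k_def[symmetric] using k(2) by (intro sum.mono_neutral_left) auto
qed

text \<open>The exponential is read off at t = 1 from exp(tE), whose coefficients are divided powers.\<close>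
lemma R_endo_exp_der:
  fixes E :: "'a::idom mpoly2 \<Rightarrow> 'a mpoly2"
  assumes Q: "Q_domain TYPE('a)" and LND: "LND E"
  shows "R_endo (exp_der E)"
proof -
  have E: "R_derivation E" using LND by (simp add: LND_def)
  define d where "d l g = rconst (inv_fact l) * (E ^^ l) g" for l g
  define P where "P g = (\<Sum>l<(LEAST m. (E ^^ m) g = 0). monom (d l g) l)" for g
  have exp: "exp_der E g = poly (P g) 1" for g
    by (simp add: exp_der_def P_def d_def poly_sum poly_monom)
  have coeff: "coeff (P g) n = d n g" for g n
  proof -
    define m where "m = (LEAST m. (E ^^ m) g = 0)"
    have "(E ^^ m) g = 0" unfolding m_def using LND by (auto simp: LND_def intro: LeastI_ex)
    then have "d n g = 0" if "m \<le> n"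
      using R_derivation_power_eq_0[OF E _ that] by (simp add: d_def)
    then show ?thesis
      unfolding P_def m_def[symmetric] by (auto simp: coeff_sum coeff_monom sum.delta' not_less)
  qed
  have d_Suc: "rconst (of_nat (Suc n)) * d (Suc n) g = E (d n g)" for n g
    unfolding d_def inv_fact_Suc[OF Q, of n, symmetric]
    by (simp only: R_derivationD(2)[OF E] rconst_mult mult.assoc funpow.simps comp_apply)
  have E_sum: "E (\<Sum>i\<in>A. p i) = (\<Sum>i\<in>A. E (p i))" for A :: "nat set" and p
    by (induction A rule: infinite_finite_induct) (simp_all add: R_derivationD[OF E])
  \<comment> \<open>Leibniz rule for divided powers. After multiplication by n + 1,
    \<open>d_Suc\<close> applies, and n + 1 = i + (n + 1 - i) recombines the two sums; the factor n
    + 1 is cancelled at the end.\<close>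
  have d_mult: "d n (a * b) = (\<Sum>i\<le>n. d i a * d (n - i) b)" for n a b
  proof (induction n)
    case 0
    have "inv_fact 0 = (1::'a)" using inv_fact[OF Q, of 0] by simp
    then show ?case by (simp add: d_def)
  next
    case (Suc n)
    let ?r = "\<lambda>n. rconst (of_nat n) :: 'a mpoly2"
    have "?r (Suc n) * d (Suc n) (a * b) = (\<Sum>i\<le>n. E (d i a * d (n - i) b))"
      unfolding d_Suc Suc E_sum ..
    also have "\<dots> = (\<Sum>i\<le>n. ?r (Suc i) * d (Suc i) a * d (n - i) b)
        + (\<Sum>i\<le>n. ?r (Suc n - i) * d i a * d (Suc n - i) b)"
      by (subst sum.distrib[symmetric], rule sum.cong)
        (simp_all only: R_derivationD(3)[OF E] Suc_diff_le atMost_iff d_Suc[symmetric] ac_simps)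
    \<comment> \<open>The summand for i = 0 added here, like the one for i = Suc n added next, has
      coefficient 0.\<close>
    also have "(\<Sum>i\<le>n. ?r (Suc i) * d (Suc i) a * d (n - i) b) = (\<Sum>i\<le>Suc n. ?r i * d i a * d (Suc n - i) b)"
      by (subst sum.atMost_Suc_shift) simp
    also have "(\<Sum>i\<le>n. ?r (Suc n - i) * d i a * d (Suc n - i) b) = (\<Sum>i\<le>Suc n. ?r (Suc n - i) * d i a * d (Suc n - i) b)"
      by simp
    also have "(\<Sum>i\<le>Suc n. ?r i * d i a * d (Suc n - i) b) + \<dots> = (\<Sum>i\<le>Suc n. ?r (Suc n) * (d i a * d (Suc n - i) b))"
    proof (subst sum.distrib[symmetric], rule sum.cong)
      fix i assume "i \<in> {..Suc n}"
      then have "?r (Suc n) = ?r i + ?r (Suc n - i)"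
        by (simp only: rconst_simps(3)[symmetric] of_nat_add[symmetric] atMost_iff le_add_diff_inverse)
      then show "?r i * d i a * d (Suc n - i) b + ?r (Suc n - i) * d i a * d (Suc n - i) b
          = ?r (Suc n) * (d i a * d (Suc n - i) b)"
        by (simp only: distrib_right mult.assoc)
    qed simp
    finally have "?r (Suc n) * d (Suc n) (a * b) = ?r (Suc n) * (\<Sum>i\<le>Suc n. d i a * d (Suc n - i) b)"
      by (simp only: sum_distrib_left)
    moreover have "?r (Suc n) \<noteq> 0"
      using Q_domain_of_nat_neq_0[OF Q, of "Suc n"] by (simp only: rconst_eq_0_iff) simp
    ultimately show ?case by (simp only: mult_cancel_left) simp
  qed
  have P_mult: "P (a * b) = P a * P b" for a b
    by (rule poly_eqI) (simp add: coeff coeff_mult d_mult)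
  have P_add: "P (a + b) = P a + P b" for a b
    by (rule poly_eqI) (simp add: coeff d_def R_derivation_power[OF E] distrib_left)
  have exp_rconst: "exp_der E (rconst c) = rconst c" for c
    using exp_der_eq_sum[OF E, of 1 "rconst c"] inv_fact[OF Q, of 0] by (simp add: R_derivationD[OF E])
  have "exp_der E (rconst 0) = rconst 0" "exp_der E (rconst 1) = rconst 1"
    by (simp_all only: exp_rconst)
  then show ?thesis
    unfolding R_hom_def rhom_def by (simp add: exp_rconst) (simp add: exp P_add P_mult)
qed

section \<open>The exponential of a kernel multiple of an affine derivation\<close>

lemma R_derivation_mult:
  assumes "R_derivation D"
  shows "R_derivation (\<lambda>g. f * D g)"
  unfolding R_derivation_def by (simp add: R_derivationD[OF assms] algebra_simps)

lemma exp_der_linear: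
  fixes D :: "'a::idom mpoly2 \<Rightarrow> 'a mpoly2"
  assumes "Q_domain TYPE('a)" "LND D" "affine_der D" "D f = 0" "linear y"
  shows "exp_der (\<lambda>g. f * D g) y = y + f * D y + rconst (inv_fact 2) * f\<^sup>2 * D (D y)"
proof -
  have D: "R_derivation D" using assms(2) by (simp add: LND_def)
  have "D (D (D y)) = 0"
    using affine_LND_square[OF assms(2,3,5)] by (rule in_R_D_eq_0[OF D])
  then have E: "f * D (f * D (f * D y)) = 0" "f * D (f * D y) = f\<^sup>2 * D (D y)"
    by (simp_all add: R_derivationD[OF D] assms(4) power2_eq_square)
  have "inv_fact 0 = (1::'a)" "inv_fact 1 = (1::'a)"
    using inv_fact[OF assms(1), of 0] inv_fact[OF assms(1), of 1] by simp_all
  then show ?thesis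
    using exp_der_eq_sum[OF R_derivation_mult[OF D], of 3 f y] E
    by (simp add: numeral_3_eq_3 numeral_2_eq_2 mult.assoc)
qed

text \<open>The inverse is the exponential for \<open>- c\<close>; as both are endomorphisms, it
  suffices to compose them on the two coordinates.\<close>

lemma affine_aut_exp_der:
  fixes D :: "'a::idom mpoly2 \<Rightarrow> 'a mpoly2"
  assumes Q: "Q_domain TYPE('a)" and "LND D" "affine_der D"
  shows "affine_aut (exp_der (\<lambda>g. rconst c * D g))"
proof -
  have D: "R_derivation D" using assms(2) by (simp add: LND_def)
  define \<phi> where "\<phi> c = exp_der (\<lambda>g. rconst c * D g)" for c
  have "((\<lambda>g. rconst c * D g) ^^ n) g = rconst (c ^ n) * (D ^^ n) g" for c n g
    by (induction n) (simp_all add: R_derivationD(2)[OF D] rconst_mult mult.assoc del: rconst_simps(6))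
  moreover have "\<exists>n. (D ^^ n) g = 0" for g using assms(2) by (auto simp: LND_def)
  ultimately have "LND (\<lambda>g. rconst c * D g)" for c
    unfolding LND_def using R_derivation_mult[OF D] by (metis mult_zero_right)
  then have hom: "R_endo (\<phi> c)" for c
    unfolding \<phi>_def by (rule R_endo_exp_der[OF Q])
  have lin: "\<phi> c y = y + rconst c * D y + rconst (inv_fact 2) * (rconst c)\<^sup>2 * D (D y)" if "linear y" for y c
    unfolding \<phi>_def using that by (intro exp_der_linear assms R_derivationD[OF D])
  have half: "rconst (inv_fact 2) + rconst (inv_fact 2) = (1 :: 'a mpoly2)"
    using inv_fact[OF Q, of 2] unfolding rconst_simps(3)[symmetric] rconst_simps(2)[symmetric] rconst_eq_iff
    by (simp add: fact_2 mult_2_right)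
  have comp: "\<phi> (- c) (\<phi> c y) = y" if y: "linear y" for y c
  proof -
    obtain s where s: "D (D y) = rconst s"
      using affine_LND_square[OF assms(2,3) y] by (auto simp: in_R_def)
    \<comment> \<open>Both quadratic terms contribute a half of c^2 D^2 y, and the product of the
      linear terms contributes -c^2 D^2 y.\<close>
    have "\<phi> (- c) (\<phi> c y) = y + (rconst (inv_fact 2) + rconst (inv_fact 2) - 1) * (rconst c)\<^sup>2 * rconst s"
      by (simp add: lin[OF y, of c] R_homD[OF hom] lin[OF y] lin[OF linear_R_derivation[OF D assms(3) y]] s
          R_derivationD[OF D] power2_eq_square algebra_simps)
    then show ?thesis unfolding half by simp
  qed
  have inverse: "\<phi> (- c) \<circ> \<phi> c = id" for c
    by (rule R_endo_eqI[OF R_hom_comp R_endo_id]) (simp_all add: hom comp)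
  have bij: "bij (\<phi> c)"
    using inverse[of c] inverse[of "- c"] by (intro o_bij[of "\<phi> (- c)"]) simp_all
  have "tdeg (\<phi> c y) = 1" if y: "linear y" "\<not> in_R y" for y
  proof -
    obtain s where s: "D (D y) = rconst s"
      using affine_LND_square[OF assms(2,3) y(1)] by (auto simp: in_R_def)
    obtain a b e a' b' e' where ye: "y = linp a b e" "D y = linp a' b' e'"
      using y(1) linear_R_derivation[OF D assms(3) y(1)] by (auto simp: linear_def)
    have "\<phi> c y = rconst 1 * linp a b e + rconst c * linp a' b' e' + rconst (inv_fact 2 * c\<^sup>2 * s)"
      unfolding lin[OF y(1)] s by (simp add: ye(1)[symmetric] ye(2)[symmetric] rconst_mult)
    then obtain a b e where phi: "\<phi> c y = linp a b e" unfolding linp_lin_comb by blast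
    \<comment> \<open>Injectivity excludes a constant image, since constants are fixed; so the
      degree is exactly 1.\<close>
    have "\<not> in_R (\<phi> c y)"
    proof
      assume "in_R (\<phi> c y)"
      then obtain k where "\<phi> c y = \<phi> c (rconst k)" by (auto simp: in_R_def R_homD[OF hom])
      then have "y = rconst k" using bij by (meson bij_is_inj injD)
      then show False using y(2) by simp
    qed
    then show ?thesis unfolding phi by (intro tdeg_linp) simp
  qed
  then have "tdeg (\<phi> c X1) = 1" "tdeg (\<phi> c X2) = 1"
    using linear_X by (simp_all add: X1_eq_linp X2_eq_linp)
  then show ?thesis
    unfolding affine_aut_def R_aut_iff \<phi>_def[symmetric] using hom bij by simp
qed

text \<open>With y = h X1, \<phi> y = y + f * g for a nonconstant g, which is of larger degree than
  \<phi> w. A relation between w, y and h X2 in which h X2 really occurs then bounds \<phi> (h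
  X2).\<close>

lemma exp_der_dg:
  fixes D :: "'a::idom mpoly2 \<Rightarrow> 'a mpoly2"
  assumes D: "LND D" "affine_der D" and f: "D f = 0" "\<not> in_R f"
    and \<phi>: "R_endo \<phi>" "\<And>y. linear y \<Longrightarrow> \<phi> y = y + f * D y + rconst \<eta> * f\<^sup>2 * D (D y)"
    and h: "h \<in> GA" and nc: "\<not> in_R (D (h X1))"
  shows "2 \<le> dg (\<phi> (h X1))" "dg (\<phi> (h X2)) \<le> dg (\<phi> (h X1))"
proof -
  have der: "R_derivation D" using D(1) by (simp add: LND_def)
  obtain a b e c d e' where hX: "h X1 = linp a b e" "h X2 = linp c d e'" and det: "(a * d - b * c) dvd 1"
    using h by (rule GA_E)
  define \<Delta> where "\<Delta> = a * d - b * c"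
  have \<Delta>: "\<Delta> \<noteq> 0" using det by (auto simp: \<Delta>_def)
  define y where "y = h X1"
  have y: "linear y" "\<not> in_R (D y)" using hX nc by (simp_all add: y_def)
  obtain s where s: "D (D y) = rconst s"
    using affine_LND_square[OF D y(1)] by (auto simp: in_R_def)
  \<comment> \<open>Factoring out f treats the cases D(D y) = 0 and D(D y) nonzero together.\<close>
  define g where "g = D y + rconst \<eta> * f * D (D y)"
  \<comment> \<open>D g = D(D y), because f and D(D y) lie in the kernel. A constant g would thus
    give D(D y) = 0 and g = D y, which is not constant.\<close>
  have "\<not> in_R g"
  proof
    assume "in_R g"
    then have "D g = 0" by (rule in_R_D_eq_0[OF der])
    then have "D (D y) = 0"
      by (simp add: g_def s R_derivationD[OF der] f(1) mult.assoc)
    with \<open>in_R g\<close> y(2) show False by (simp add: g_def)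
  qed
  have pos: "1 \<le> dg f" "1 \<le> dg g" using f(2) \<open>\<not> in_R g\<close> by (simp_all add: in_R_iff_dg)
  then have fg: "dg (f * g) = dg f + dg g" by (intro dg_mult) auto
  have "\<phi> y = y + f * g"
    by (simp add: \<phi>(2)[OF y(1)] g_def power2_eq_square algebra_simps)
  moreover have "dg y < dg (f * g)" using linear_dg[OF y(1)] fg pos by simp
  ultimately have dg_y: "dg (\<phi> y) = dg f + dg g" using fg by (simp add: dg_add_eq_right)
  then show "2 \<le> dg (\<phi> (h X1))" using pos by (simp add: y_def)
  obtain w where w: "linear w" "\<not> in_R w" "in_R (D w)"
    using affine_LND_constant_image[OF D] .
  obtain p q r where w': "w = linp p q r" using w(1) by (auto simp: linear_def)
  \<comment> \<open>Cramer coefficients of \<Delta> * w with respect to h X1, h X2 and 1. If \<beta>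
    were 0, D y would be constant or w would be.\<close>
  define \<alpha> \<beta> \<gamma> where "\<alpha> = p * d - q * c" and "\<beta> = a * q - b * p"
    and "\<gamma> = \<Delta> * r - \<alpha> * e - \<beta> * e'"
  have rel: "rconst \<Delta> * w = rconst \<alpha> * h X1 + rconst \<beta> * h X2 + rconst \<gamma>"
    unfolding hX w' \<alpha>_def \<beta>_def \<gamma>_def \<Delta>_def by (rule cramer_linp)
  have \<beta>: "\<beta> \<noteq> 0"
  proof
    assume "\<beta> = 0"
    then have "rconst \<alpha> * D y = rconst \<Delta> * D w"
      using arg_cong[OF rel, of D] by (simp add: R_derivationD[OF der] y_def)
    then have "in_R (rconst \<alpha> * D y)" using w(3) by (simp add: in_R_rconst_mult)
    then have "\<alpha> = 0" using y(2) by (simp add: in_R_rconst_mult_iff)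
    then have "in_R (rconst \<Delta> * w)" unfolding rel using \<open>\<beta> = 0\<close> by simp
    then show False using \<Delta> w(2) by (simp add: in_R_rconst_mult_iff)
  qed
  obtain k where k: "D w = rconst k" using w(3) by (auto simp: in_R_def)
  have "\<phi> w = w + rconst k * f"
    by (simp add: \<phi>(2)[OF w(1)] k R_derivationD[OF der] mult.commute)
  then have dg_w: "dg (\<phi> w) < dg f + dg g"
    using dg_add_less[of w "dg f + dg g" "rconst k * f"] linear_dg[OF w(1)] pos dg_rconst_mult_le[of k f]
    by simp
  \<comment> \<open>The relation for w, mapped by \<phi> and solved for h X2: no term on the right
    exceeds the degree of \<phi> y.\<close>
  have "rconst \<beta> * \<phi> (h X2) = (rconst \<Delta> * \<phi> w + rconst (- \<gamma>)) + rconst (- \<alpha>) * \<phi> y"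
    using arg_cong[OF rel, of \<phi>] by (simp add: R_homD[OF \<phi>(1)] y_def algebra_simps)
  then have "dg (rconst \<beta> * \<phi> (h X2)) < Suc (dg f + dg g)"
    using dg_w dg_y dg_rconst_mult_le[of \<Delta> "\<phi> w"] dg_rconst_mult_le[of "- \<alpha>" "\<phi> y"]
    by (simp only:) (intro dg_add_less; simp del: rconst_simps)
  then show "dg (\<phi> (h X2)) \<le> dg (\<phi> (h X1))"
    using \<beta> dg_y by (simp add: y_def)
qed

theorem theorem3p3p1:
  fixes D :: "'a::idom mpoly2 \<Rightarrow> 'a mpoly2" and f :: "'a mpoly2"
  assumes "Q_domain TYPE('a)"
    and "LND D"
    and "affine_der D"
    and "\<forall>\<psi> \<in> Aff. \<not> triangular_der (inv \<psi> \<circ> D \<circ> \<psi>)"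
    and "D f = 0"
  shows "exp_der (\<lambda>g. f * D g) \<in> Tame \<longleftrightarrow> in_R f"
proof
  assume "in_R f"
  then obtain c where "f = rconst c" by (auto simp: in_R_def)
  then have "affine_aut (exp_der (\<lambda>g. f * D g))"
    using affine_aut_exp_der[OF assms(1-3)] by simp
  then show "exp_der (\<lambda>g. f * D g) \<in> Tame"
    unfolding Tame_def by (intro gen_group.gen_base) simp
next
  define \<phi> where "\<phi> = exp_der (\<lambda>g. f * D g)"
  assume "exp_der (\<lambda>g. f * D g) \<in> Tame"
  then have \<phi>: "\<phi> \<in> words" using Tame_subset_words by (auto simp: \<phi>_def)
  have nontriangular: "\<not> in_R (D (h X1))" if "h \<in> GA" for h
  proof -
    have "h \<in> Aff"
      unfolding Aff_def using affine_aut_if_GA[OF that] by (intro gen_group.gen_base) simp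
    then show ?thesis using assms(4) triangular_conj[OF assms(2,3) that] by blast
  qed
  have linear: "\<phi> y = y + f * D y + rconst (inv_fact 2) * f\<^sup>2 * D (D y)" if "linear y" for y
    unfolding \<phi>_def by (rule exp_der_linear[OF assms(1,2,3,5) that])
  show "in_R f"
  proof (rule ccontr)
    assume nc: "\<not> in_R f"
    note dg = exp_der_dg[OF assms(2,3,5) nc _ linear _ nontriangular]
    from words_cases[OF \<phi>] consider "\<phi> \<in> GA" | k a where "k \<in> reduced" "a \<in> GA" "\<phi> = k \<circ> a"
      by blast
    then show False
    proof cases
      case 1
      \<comment> \<open>With h = id, the image of X1 would have degree at least 2, although an
        affine map keeps it at most 1.\<close>
      then show False
        using dg(1)[OF GA_R_endo[OF 1] _ GA_id GA_id] linear_dg[OF linear_GA[OF 1 linear_X(1)]] by simp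
    next
      case (2 k a)
      note b = GA_inv[OF 2(2)]
      have "R_endo \<phi>"
        unfolding 2(3) using reduced_dg[OF 2(1)] GA_R_endo[OF 2(2)] by (blast intro: R_hom_comp)
      \<comment> \<open>In the coordinates given by \<open>inv a\<close>, \<phi> acts as the reduced
        word k, whose degrees satisfy the opposite strict inequality.\<close>
      then have "dg (\<phi> (inv a X2)) \<le> dg (\<phi> (inv a X1))"
        by (rule dg(2)[OF _ _ b(1) b(1)])
      then show False
        using reduced_dg[OF 2(1)] by (simp add: 2(3) b)
    qed
  qed
qed

end
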